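(* Let $n > 4$ be an integer and let $\Gamma = Q_n^2$ be the square of the hypercube $Q_n$. Then $\mathrm{Aut}(\Gamma) \cong \mathbb{Z}_2^n \rtimes \mathrm{Sym}([n+1])$.
   Context: All graphs are finite, simple and undirected. The hypercube $Q_n$ is the graph with vertex set $\{0,1\}^n$ in which two $n$-tuples are adjacent if and only if they differ in precisely one coordinate. For a graph $\Gamma=(V,E)$, the square $\Gamma^2$ is the simple graph with vertex set $V$ in which two distinct vertices are adjacent if and only if their distance in $\Gamma$ is at most two. $\mathrm{Aut}(\Gamma)$ denotes the automorphism group of a graph $\Gamma$ (adjacency-preserving permutations of the vertex set under composition). $[m]=\{1,\dots,m\}$, $\mathrm{Sym}([m])$ is the group of all permutations of $[m]$, and $\mathbb{Z}_2$ is the cyclic group of order 2. A group $G$ is called a semidirect product of $N$ by $Q$, denoted $G = N \rtimes Q$, if $G$ contains subgroups $N$ and $Q$ such that (i) $N$ is normal in $G$, (ii) $NQ = G$, and (iii) $N\cap Q = 1$. Thus $\mathrm{Aut}(\Gamma) \cong \mathbb{Z}_2^n \rtimes \mathrm{Sym}([n+1])$ means that $\mathrm{Aut}(\Gamma)$ is a semidirect product, in this sense, of a subgroup isomorphic to $\mathbb{Z}_2^n$ by a subgroup isomorphic to $\mathrm{Sym}([n+1])$. *)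

theory Defs
  imports
    "Graph_Theory.Graph_Theory"
    "HOL-Algebra.Sym_Groups"
    "HOL-Algebra.Product_Groups"
    "HOL-Algebra.Elementary_Groups"
    "HOL-Algebra.Bij"
begin

text \<open>
  Finite simple undirected graphs are modelled as in Graph_Theory, i.e. by the locale
  \<^locale>\<open>pair_graph\<close> of finite loop-free digraphs with a symmetric arc relation.
\<close>

definition hypercube :: "nat \<Rightarrow> (nat \<Rightarrow> nat) pair_pre_digraph" where
  "hypercube n =
    \<lparr> pverts = {1..n} \<rightarrow>\<^sub>E {0, 1},
      parcs = {(x, y). x \<in> {1..n} \<rightarrow>\<^sub>E {0, 1} \<and> y \<in> {1..n} \<rightarrow>\<^sub>E {0, 1} \<and>
                       card {i \<in> {1..n}. x i \<noteq> y i} = 1} \<rparr>"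

text \<open>
  The library's \<^term>\<open>wf_digraph.\<mu>\<close> is the infimum of the weights of the walks from one vertex
  to another (\<open>\<infinity>\<close> if there is none); unit weights give the usual distance.
\<close>

definition graph_dist :: "'a pair_pre_digraph \<Rightarrow> 'a \<Rightarrow> 'a \<Rightarrow> ereal" where
  "graph_dist G u v = wf_digraph.\<mu> (with_proj G) (\<lambda>_. 1) u v"

definition graph_square :: "'a pair_pre_digraph \<Rightarrow> 'a pair_pre_digraph" where
  "graph_square G =
    \<lparr> pverts = pverts G,
      parcs = {(u, v). u \<in> pverts G \<and> v \<in> pverts G \<and> u \<noteq> v \<and> graph_dist G u v \<le> 2} \<rparr>"

text \<open>
  As in \<^const>\<open>BijGroup\<close>, permutations of the vertex set are represented by functions that are
  \<^const>\<open>undefined\<close> outside it.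
\<close>

definition graph_aut :: "'a pair_pre_digraph \<Rightarrow> ('a \<Rightarrow> 'a) set" where
  "graph_aut G =
    {f \<in> Bij (pverts G). \<forall>u \<in> pverts G. \<forall>v \<in> pverts G.
      (f u, f v) \<in> parcs G \<longleftrightarrow> (u, v) \<in> parcs G}"

definition graph_aut_group :: "'a pair_pre_digraph \<Rightarrow> ('a \<Rightarrow> 'a) monoid" where
  "graph_aut_group G = BijGroup (pverts G) \<lparr>carrier := graph_aut G\<rparr>"

definition semidirect_product_of :: "('a, 'b) monoid_scheme \<Rightarrow> 'a set \<Rightarrow> 'a set \<Rightarrow> bool" where
  "semidirect_product_of G N Q \<longleftrightarrow>
    N \<lhd> G \<and> subgroup Q G \<and> N <#>\<^bsub>G\<^esub> Q = carrier G \<and> N \<inter> Q = {\<one>\<^bsub>G\<^esub>}"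

text \<open>
  \<open>G \<cong> A \<rtimes> B\<close> in the internal sense: the action of \<open>B\<close> on \<open>A\<close> is not specified.
\<close>

definition iso_semidirect_product ::
  "('a, 'b) monoid_scheme \<Rightarrow> ('c, 'd) monoid_scheme \<Rightarrow> ('e, 'f) monoid_scheme \<Rightarrow> bool" where
  "iso_semidirect_product G A B \<longleftrightarrow>
    (\<exists>N Q. semidirect_product_of G N Q \<and> G\<lparr>carrier := N\<rparr> \<cong> A \<and> G\<lparr>carrier := Q\<rparr> \<cong> B)"

lemma pair_graph_hypercube: "pair_graph (hypercube n)"
proof
  have fin: "finite ({1..n} \<rightarrow>\<^sub>E {0, 1::nat})"
    by (intro finite_PiE) auto
  then show "finite (pverts (hypercube n))"
    by (simp add: hypercube_def)
  have sub: "parcs (hypercube n) \<subseteq> ({1..n} \<rightarrow>\<^sub>E {0, 1}) \<times> ({1..n} \<rightarrow>\<^sub>E {0, 1})"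
    unfolding hypercube_def by clarsimp
  have verts: "pverts (hypercube n) = {1..n} \<rightarrow>\<^sub>E {0, 1}"
    by (simp add: hypercube_def)
  fix e assume "e \<in> parcs (hypercube n)"
  with sub verts show "fst e \<in> pverts (hypercube n)" "snd e \<in> pverts (hypercube n)"
    by (metis mem_Sigma_iff prod.collapse subsetD)+
  from \<open>e \<in> parcs (hypercube n)\<close> show "fst e \<noteq> snd e"
    by (clarsimp simp: hypercube_def)
next
  have "parcs (hypercube n) \<subseteq> ({1..n} \<rightarrow>\<^sub>E {0, 1}) \<times> ({1..n} \<rightarrow>\<^sub>E {0, 1})"
    unfolding hypercube_def by clarsimp
  moreover have fin: "finite ({1..n} \<rightarrow>\<^sub>E {0, 1::nat})"
    by (intro finite_PiE) auto
  ultimately show "finite (parcs (hypercube n))"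
    by (meson finite_SigmaI finite_subset)
  have diff: "{i \<in> {1..n}. x i \<noteq> y i} = {i \<in> {1..n}. y i \<noteq> x i}" for x y :: "nat \<Rightarrow> nat"
    by (rule Collect_cong) metis
  have "sym (parcs (hypercube n))"
  proof (rule symI)
    fix x y assume "(x, y) \<in> parcs (hypercube n)"
    then show "(y, x) \<in> parcs (hypercube n)"
      using diff[of x y] unfolding hypercube_def
      by (metis (no_types, lifting) case_prodD case_prodI mem_Collect_eq pair_pre_digraph.select_convs(2))
  qed
  then show "symmetric (with_proj (hypercube n))"
    by (simp add: symmetric_def)
qed

lemma (in pair_graph) graph_dist_commute_le:
  "graph_dist G u v \<le> graph_dist G v u"
proof -
  have rev: "\<exists>q. awalk u q v \<and> length q = length p" if "awalk v p u" for p
    using that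
  proof (induction p arbitrary: v)
    case Nil
    then show ?case
      by (intro exI[of _ "[]"]) (auto simp: awalk_Nil_iff)
  next
    case (Cons e p)
    then have e: "e \<in> parcs G" "fst e = v" and p: "awalk (snd e) p u"
      by (auto simp: awalk_Cons_iff)
    from Cons.IH[OF p] obtain q where q: "awalk u q (snd e)" "length q = length p"
      by blast
    have "(snd e, v) \<in> parcs G"
      using e pair_sym_arcs unfolding symmetric_def sym_def
      by (metis prod.collapse with_proj_simps(3))
    then have "awalk (snd e) [(snd e, v)] v"
      by (auto simp: awalk_Cons_iff awalk_Nil_iff dest: arc_snd_in_verts arc_fst_in_verts)
    with q have "awalk u (q @ [(snd e, v)]) v"
      by (meson awalk_appendI)
    with q show ?case
      by (intro exI[of _ "q @ [(snd e, v)]"]) auto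
  qed
  have cost: "awalk_cost (\<lambda>_. 1) p = real (length p)" for p :: "('a \<times> 'a) list"
    by (induction p) auto
  show ?thesis
    unfolding graph_dist_def \<mu>_def cost
    by (rule INF_mono) (use rev in fastforce)
qed

lemma (in pair_graph) pair_graph_graph_square: "pair_graph (graph_square G)"
proof
  show "finite (pverts (graph_square G))"
    by (simp add: graph_square_def pair_finite_verts)
  have "parcs (graph_square G) \<subseteq> pverts G \<times> pverts G"
    by (auto simp: graph_square_def)
  then show "finite (parcs (graph_square G))"
    using pair_finite_verts by (meson finite_SigmaI finite_subset)
  show "symmetric (with_proj (graph_square G))"
    unfolding symmetric_def arcs_ends_conv
    by (auto simp: graph_square_def sym_def intro: order_trans[OF graph_dist_commute_le])
qed (auto simp: graph_square_def)

lemma subgroup_graph_aut: "subgroup (graph_aut G) (BijGroup (pverts G))"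
proof -
  interpret B: group "BijGroup (pverts G)"
    by (rule group_BijGroup)
  show ?thesis
  proof
    show "graph_aut G \<subseteq> carrier (BijGroup (pverts G))"
      by (auto simp: graph_aut_def BijGroup_def)
    show "\<one>\<^bsub>BijGroup (pverts G)\<^esub> \<in> graph_aut G"
      by (auto simp: graph_aut_def BijGroup_def id_Bij)
  next
    fix f g assume "f \<in> graph_aut G" "g \<in> graph_aut G"
    then show "f \<otimes>\<^bsub>BijGroup (pverts G)\<^esub> g \<in> graph_aut G"
      by (auto simp: graph_aut_def BijGroup_def compose_Bij compose_eq
          dest: Bij_imp_funcset)
  next
    fix f assume f: "f \<in> graph_aut G"
    then have fB: "f \<in> Bij (pverts G)"
      by (simp add: graph_aut_def)
    define h where "h = (\<lambda>x \<in> pverts G. inv_into (pverts G) f x)"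
    have surj: "f ` pverts G = pverts G"
      using fB by (auto simp: Bij_def bij_betw_def)
    have hmem: "h x \<in> pverts G" and fh: "f (h x) = x" if "x \<in> pverts G" for x
      using that surj by (auto simp: h_def inv_into_into f_inv_into_f)
    have "(h u, h v) \<in> parcs G \<longleftrightarrow> (u, v) \<in> parcs G"
      if uv: "u \<in> pverts G" "v \<in> pverts G" for u v
    proof -
      have "(f (h u), f (h v)) \<in> parcs G \<longleftrightarrow> (h u, h v) \<in> parcs G"
        using f hmem uv unfolding graph_aut_def by blast
      then show ?thesis
        by (simp add: fh uv)
    qed
    moreover have "h \<in> Bij (pverts G)"
      using fB restrict_inv_into_Bij unfolding h_def by blast
    ultimately show "inv\<^bsub>BijGroup (pverts G)\<^esub> f \<in> graph_aut G"
      using fB by (simp add: inv_BijGroup graph_aut_def h_def)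
  qed
qed

lemma group_graph_aut_group: "group (graph_aut_group G)"
  unfolding graph_aut_group_def
  by (rule subgroup.subgroup_is_group[OF subgroup_graph_aut group_BijGroup])

end

theory Submission
  imports Defs
begin

text \<open>The square of the \<open>n\<close>-dimensional hypercube is the halved cube on
  \<open>n + 1\<close> points. Adding a parity bit to 0-1 vectors turns Hamming distance one or two
  into a symmetric difference of size exactly two, because two even sets have an even symmetric
  difference. In this form all permutations of the \<open>n + 1\<close> points act
  (\<open>image_aut\<close>), and so do the translations by even sets (\<open>translation\<close>).

  There are no automorphisms beyond products of these. After composition with a translation, an
  automorphism fixes the empty set and hence permutes its neighbours, the two-element sets. Two
  distinct pairs are adjacent iff they meet, and more than three pairwise meeting pairs have a
  common point (\<open>pairwise_intersecting_pairs\<close>). With at least five points, the pairs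
  through one point are therefore sent to pairs through one point, which defines a permutation
  (\<open>graph_aut_fixing_empty\<close>). Once this permutation is undone, all pairs are fixed, and
  then every even set is fixed by induction on its size (\<open>fixes_pairs_imp_fixes_all\<close>).

  Conjugation by a permutation sends translations to translations
  (\<open>image_aut_translation\<close>), so the translations form a normal subgroup. It meets the
  permutations trivially, since a translation fixing the empty set is the identity.
  \<open>iso_semidirect_product_halved_cube\<close> assembles the decomposition;
  \<open>graph_aut_group_square_hypercube\<close> and \<open>iso_semidirect_product_cong\<close>
  carry it over to the hypercube.\<close>

section \<open>Groups\<close>

text \<open>The two subgroups are the images of the embeddings \<alpha> and \<beta>. Normality is
  phrased as moving an element of the first image past \<open>g\<close>, which keeps inverses out of
  the later computations.\<close>

lemma iso_semidirect_productI:
  assumes G: "group G" and A: "group A" and B: "group B"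
    and \<alpha>: "\<alpha> \<in> hom A G" "inj_on \<alpha> (carrier A)"
    and \<beta>: "\<beta> \<in> hom B G" "inj_on \<beta> (carrier B)"
    and normal: "\<And>g a. g \<in> carrier G \<Longrightarrow> a \<in> carrier A \<Longrightarrow>
      \<exists>a' \<in> carrier A. g \<otimes>\<^bsub>G\<^esub> \<alpha> a = \<alpha> a' \<otimes>\<^bsub>G\<^esub> g"
    and prod: "\<And>g. g \<in> carrier G \<Longrightarrow> \<exists>a \<in> carrier A. \<exists>b \<in> carrier B. g = \<alpha> a \<otimes>\<^bsub>G\<^esub> \<beta> b"
    and int: "\<And>a b. a \<in> carrier A \<Longrightarrow> b \<in> carrier B \<Longrightarrow> \<alpha> a = \<beta> b \<Longrightarrow> \<alpha> a = \<one>\<^bsub>G\<^esub>"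
  shows "iso_semidirect_product G A B"
proof -
  interpret G: group G by fact
  interpret \<alpha>: group_hom A G \<alpha>
    using A G \<alpha> by (simp add: group_hom_def group_hom_axioms_def)
  interpret \<beta>: group_hom B G \<beta>
    using B G \<beta> by (simp add: group_hom_def group_hom_axioms_def)
  let ?N = "\<alpha> ` carrier A" and ?Q = "\<beta> ` carrier B"
  have "?N \<lhd> G"
    unfolding G.normal_inv_iff
  proof (intro conjI ballI)
    show "subgroup ?N G" by (rule \<alpha>.img_is_subgroup)
    fix g h assume g: "g \<in> carrier G" and "h \<in> ?N"
    then obtain a a' where "a' \<in> carrier A" "h = \<alpha> a" "a \<in> carrier A" "g \<otimes>\<^bsub>G\<^esub> \<alpha> a = \<alpha> a' \<otimes>\<^bsub>G\<^esub> g"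
      using normal by blast
    then have "g \<otimes>\<^bsub>G\<^esub> h \<otimes>\<^bsub>G\<^esub> inv\<^bsub>G\<^esub> g = \<alpha> a'"
      using g by (simp add: G.m_assoc)
    then show "g \<otimes>\<^bsub>G\<^esub> h \<otimes>\<^bsub>G\<^esub> inv\<^bsub>G\<^esub> g \<in> ?N"
      using \<open>a' \<in> carrier A\<close> by simp
  qed
  moreover have "subgroup ?Q G" by (rule \<beta>.img_is_subgroup)
  moreover have "?N <#>\<^bsub>G\<^esub> ?Q = carrier G"
    using prod by (fastforce simp: set_mult_def)
  moreover have "?N \<inter> ?Q = {\<one>\<^bsub>G\<^esub>}"
  proof -
    have "\<one>\<^bsub>G\<^esub> \<in> ?N" "\<one>\<^bsub>G\<^esub> \<in> ?Q"
      by (metis \<alpha>.hom_one \<alpha>.G.one_closed image_eqI) (metis \<beta>.hom_one \<beta>.G.one_closed image_eqI)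
    moreover have "x = \<one>\<^bsub>G\<^esub>" if "x \<in> ?N" "x \<in> ?Q" for x
      using that int by (metis imageE)
    ultimately show ?thesis by blast
  qed
  moreover have "G\<lparr>carrier := ?N\<rparr> \<cong> A"
  proof (rule group.iso_sym[OF A], rule is_isoI)
    show "\<alpha> \<in> iso A (G\<lparr>carrier := ?N\<rparr>)"
      using \<alpha> by (auto simp: iso_def hom_def bij_betw_def)
  qed
  moreover have "G\<lparr>carrier := ?Q\<rparr> \<cong> B"
  proof (rule group.iso_sym[OF B], rule is_isoI)
    show "\<beta> \<in> iso B (G\<lparr>carrier := ?Q\<rparr>)"
      using \<beta> by (auto simp: iso_def hom_def bij_betw_def)
  qed
  ultimately show ?thesis
    unfolding iso_semidirect_product_def semidirect_product_of_def by blast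
qed

text \<open>An isomorphism maps the two subgroups to subgroups with the same properties, and its
  restriction to each is an isomorphism onto the image. This allows the group to be computed on the
  halved cube.\<close>

lemma iso_semidirect_product_cong:
  assumes G: "group G" and H: "group H" and "G \<cong> H" and "iso_semidirect_product G A B"
  shows "iso_semidirect_product H A B"
proof -
  obtain \<phi> where \<phi>: "\<phi> \<in> iso G H"
    using \<open>G \<cong> H\<close> by (auto simp: is_iso_def)
  obtain N Q where N: "N \<lhd> G" and Q: "subgroup Q G" and NQ: "N <#>\<^bsub>G\<^esub> Q = carrier G"
      "N \<inter> Q = {\<one>\<^bsub>G\<^esub>}" and iso: "G\<lparr>carrier := N\<rparr> \<cong> A" "G\<lparr>carrier := Q\<rparr> \<cong> B"
    using assms(4) unfolding iso_semidirect_product_def semidirect_product_of_def by blast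
  interpret \<phi>: group_hom G H \<phi>
    using G H \<phi> by (simp add: group_hom_def group_hom_axioms_def iso_def)
  have inj: "inj_on \<phi> (carrier G)" and surj: "\<phi> ` carrier G = carrier H"
    using \<phi> by (auto simp: iso_def bij_betw_def)
  have sub: "N \<subseteq> carrier G" "Q \<subseteq> carrier G"
    using N Q by (auto dest: subgroup.subset normal_imp_subgroup)
  have transfer: "H\<lparr>carrier := \<phi> ` S\<rparr> \<cong> C" if "subgroup S G" "G\<lparr>carrier := S\<rparr> \<cong> C" for S C
  proof -
    have "S \<subseteq> carrier G" using that by (auto dest: subgroup.subset)
    then have "\<phi> \<in> iso (G\<lparr>carrier := S\<rparr>) (H\<lparr>carrier := \<phi> ` S\<rparr>)"
      using inj_on_subset[OF inj] by (auto simp: iso_def hom_def bij_betw_def subset_iff)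
    then have "G\<lparr>carrier := S\<rparr> \<cong> H\<lparr>carrier := \<phi> ` S\<rparr>" by (rule is_isoI)
    then show ?thesis
      using that group.iso_sym subgroup.subgroup_is_group G iso_trans by blast
  qed
  have "\<phi> ` N \<lhd> H"
    using \<phi> G H N iso_normal_subgroup by blast
  moreover have "subgroup (\<phi> ` Q) H"
    using Q \<phi>.subgroup_img_is_subgroup by blast
  moreover have "\<phi> ` N <#>\<^bsub>H\<^esub> \<phi> ` Q = carrier H"
  proof -
    have "\<phi> ` N <#>\<^bsub>H\<^esub> \<phi> ` Q = \<phi> ` (N <#>\<^bsub>G\<^esub> Q)"
      using sub by (force simp: set_mult_def subset_iff)
    then show ?thesis by (simp add: NQ surj)
  qed
  moreover have "\<phi> ` N \<inter> \<phi> ` Q = {\<one>\<^bsub>H\<^esub>}"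
    using inj_on_image_Int[OF inj sub] by (simp add: NQ)
  ultimately show ?thesis
    unfolding iso_semidirect_product_def semidirect_product_of_def
    using transfer[OF normal_imp_subgroup[OF N] iso(1)] transfer[OF Q iso(2)] by blast
qed

section \<open>Automorphism groups of graphs and their invariance under graph isomorphism\<close>

lemma carrier_graph_aut_group [simp]: "carrier (graph_aut_group G) = graph_aut G"
  by (simp add: graph_aut_group_def)

lemma one_graph_aut_group: "\<one>\<^bsub>graph_aut_group G\<^esub> = (\<lambda>x \<in> pverts G. x)"
  by (simp add: graph_aut_group_def BijGroup_def)

lemma mult_graph_aut_group:
  "f \<in> graph_aut G \<Longrightarrow> g \<in> graph_aut G \<Longrightarrow> f \<otimes>\<^bsub>graph_aut_group G\<^esub> g = compose (pverts G) f g"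
  by (simp add: graph_aut_group_def BijGroup_def graph_aut_def)

lemma compose_graph_aut:
  "f \<in> graph_aut G \<Longrightarrow> g \<in> graph_aut G \<Longrightarrow> compose (pverts G) f g \<in> graph_aut G"
  using monoid.m_closed[OF group.is_monoid[OF group_graph_aut_group], of f G g]
  by (simp add: mult_graph_aut_group)

lemma graph_aut_in_verts: "f \<in> graph_aut G \<Longrightarrow> x \<in> pverts G \<Longrightarrow> f x \<in> pverts G"
  by (auto simp: graph_aut_def dest: Bij_imp_funcset)

lemma graph_aut_inj: "f \<in> graph_aut G \<Longrightarrow> x \<in> pverts G \<Longrightarrow> y \<in> pverts G \<Longrightarrow> f x = f y \<longleftrightarrow> x = y"
  by (auto simp: graph_aut_def Bij_def bij_betw_def inj_on_def)

lemma graph_aut_arc_iff: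
  "f \<in> graph_aut G \<Longrightarrow> x \<in> pverts G \<Longrightarrow> y \<in> pverts G \<Longrightarrow> (f x, f y) \<in> parcs G \<longleftrightarrow> (x, y) \<in> parcs G"
  by (auto simp: graph_aut_def)

lemma graph_aut_extensional: "f \<in> graph_aut G \<Longrightarrow> f \<in> extensional (pverts G)"
  by (auto simp: graph_aut_def Bij_def)

text \<open>Both mutually inverse maps are parameters, so that \<open>graph_aut_group_cong\<close>
  can use the lemma for conjugation in either direction.\<close>

lemma conjugate_graph_aut:
  assumes k: "k \<in> pverts H \<rightarrow> pverts G" and h: "h \<in> pverts G \<rightarrow> pverts H"
    and hk: "\<And>y. y \<in> pverts H \<Longrightarrow> h (k y) = y" and kh: "\<And>x. x \<in> pverts G \<Longrightarrow> k (h x) = x"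
    and arcs: "\<And>u v. u \<in> pverts G \<Longrightarrow> v \<in> pverts G \<Longrightarrow> (h u, h v) \<in> parcs H \<longleftrightarrow> (u, v) \<in> parcs G"
    and f: "f \<in> graph_aut G"
  shows "(\<lambda>y \<in> pverts H. h (f (k y))) \<in> graph_aut H"
proof -
  have "bij_betw k (pverts H) (pverts G)"
    using k h hk kh by (intro bij_betw_byWitness[where f' = h]) auto
  moreover have "bij_betw h (pverts G) (pverts H)"
    using k h hk kh by (intro bij_betw_byWitness[where f' = k]) auto
  moreover have "bij_betw f (pverts G) (pverts G)"
    using f by (simp add: graph_aut_def Bij_def)
  ultimately have "bij_betw (h \<circ> (f \<circ> k)) (pverts H) (pverts H)"
    by (metis bij_betw_trans)
  then have "(\<lambda>y \<in> pverts H. h (f (k y))) \<in> Bij (pverts H)"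
    by (simp add: Bij_def comp_def)
  moreover have "(h (f (k u)), h (f (k v))) \<in> parcs H \<longleftrightarrow> (u, v) \<in> parcs H"
    if "u \<in> pverts H" "v \<in> pverts H" for u v
  proof -
    have ku: "k u \<in> pverts G" "k v \<in> pverts G" using that k by auto
    then show ?thesis
      using arcs[of "f (k u)" "f (k v)"] arcs[of "k u" "k v"] f that
      by (simp add: graph_aut_in_verts graph_aut_arc_iff hk)
  qed
  ultimately show ?thesis by (simp add: graph_aut_def)
qed

lemma graph_aut_group_cong:
  assumes h: "bij_betw h (pverts G) (pverts H)"
    and arcs: "\<And>u v. u \<in> pverts G \<Longrightarrow> v \<in> pverts G \<Longrightarrow> (h u, h v) \<in> parcs H \<longleftrightarrow> (u, v) \<in> parcs G"
  shows "graph_aut_group G \<cong> graph_aut_group H"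
proof -
  define k where "k = inv_into (pverts G) h"
  define \<Phi> where "\<Phi> f = (\<lambda>y \<in> pverts H. h (f (k y)))" for f
  define \<Psi> where "\<Psi> g = (\<lambda>x \<in> pverts G. k (g (h x)))" for g
  have hG: "h \<in> pverts G \<rightarrow> pverts H" and kH: "k \<in> pverts H \<rightarrow> pverts G"
    using h bij_betw_imp_funcset bij_betw_inv_into unfolding k_def by blast+
  have hk: "h (k y) = y" if "y \<in> pverts H" for y
    using h that unfolding k_def by (rule bij_betw_inv_into_right)
  have kh: "k (h x) = x" if "x \<in> pverts G" for x
    using h that unfolding k_def by (rule bij_betw_inv_into_left)
  have \<Phi>: "\<Phi> f \<in> graph_aut H" if "f \<in> graph_aut G" for f
    unfolding \<Phi>_def using conjugate_graph_aut[of k H G h f, OF kH hG hk kh arcs that] .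
  have karcs: "(k u, k v) \<in> parcs G \<longleftrightarrow> (u, v) \<in> parcs H"
    if "u \<in> pverts H" "v \<in> pverts H" for u v
    using arcs[of "k u" "k v"] kH that by (simp add: hk Pi_iff)
  have \<Psi>: "\<Psi> g \<in> graph_aut G" if "g \<in> graph_aut H" for g
    unfolding \<Psi>_def using conjugate_graph_aut[of h G H k g, OF hG kH kh hk karcs that] .
  have "bij_betw \<Phi> (graph_aut G) (graph_aut H)"
  proof (rule bij_betw_byWitness[where f' = \<Psi>])
    show "\<forall>f \<in> graph_aut G. \<Psi> (\<Phi> f) = f"
    proof
      fix f assume f: "f \<in> graph_aut G"
      show "\<Psi> (\<Phi> f) = f"
      proof (rule extensionalityI)
        show "\<Psi> (\<Phi> f) \<in> extensional (pverts G)" by (simp add: \<Psi>_def)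
        show "f \<in> extensional (pverts G)" using f by (rule graph_aut_extensional)
        show "\<Psi> (\<Phi> f) x = f x" if "x \<in> pverts G" for x
          using that f hG by (simp add: \<Phi>_def \<Psi>_def kh Pi_iff graph_aut_in_verts)
      qed
    qed
    show "\<forall>g \<in> graph_aut H. \<Phi> (\<Psi> g) = g"
    proof
      fix g assume g: "g \<in> graph_aut H"
      show "\<Phi> (\<Psi> g) = g"
      proof (rule extensionalityI)
        show "\<Phi> (\<Psi> g) \<in> extensional (pverts H)" by (simp add: \<Phi>_def)
        show "g \<in> extensional (pverts H)" using g by (rule graph_aut_extensional)
        show "\<Phi> (\<Psi> g) x = g x" if "x \<in> pverts H" for x
          using that g kH by (simp add: \<Phi>_def \<Psi>_def hk Pi_iff graph_aut_in_verts)
      qed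
    qed
  qed (use \<Phi> \<Psi> in auto)
  moreover have "\<Phi> (compose (pverts G) f g) = compose (pverts H) (\<Phi> f) (\<Phi> g)"
    if "f \<in> graph_aut G" "g \<in> graph_aut G" for f g
    using that hG kH by (auto simp: \<Phi>_def compose_def fun_eq_iff restrict_def kh Pi_iff graph_aut_in_verts)
  ultimately have "\<Phi> \<in> iso (graph_aut_group G) (graph_aut_group H)"
    using \<Phi> by (auto simp: iso_def hom_def mult_graph_aut_group compose_graph_aut)
  then show ?thesis by (rule is_isoI)
qed

section \<open>The halved cube\<close>

text \<open>
  Dropping one coordinate identifies the halved cube on \<open>n + 1\<close> points with the square
  of the \<open>n\<close>-dimensional hypercube; in this model all \<open>n + 1\<close> coordinates play the same role.
\<close>

definition halved_cube :: "'a set \<Rightarrow> 'a set pair_pre_digraph" where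
  "halved_cube M =
    \<lparr> pverts = {A. A \<subseteq> M \<and> even (card A)},
      parcs = {(A, B). A \<subseteq> M \<and> even (card A) \<and> B \<subseteq> M \<and> even (card B) \<and> card (sym_diff A B) = 2} \<rparr>"

text \<open>Each common point is counted once in \<open>A\<close> and once in \<open>B\<close>. The
  additive form avoids truncated subtraction and makes the parity rule
  \<open>even_card_sym_diff\<close> immediate.\<close>

lemma card_sym_diff:
  assumes "finite A" "finite B"
  shows "card (sym_diff A B) + 2 * card (A \<inter> B) = card A + card B"
proof -
  have "card (sym_diff A B) = card (A - B) + card (B - A)"
    using assms by (intro card_Un_disjoint) auto
  moreover have "card A = card (A - B) + card (A \<inter> B)"
    using assms(1) by (metis card_Diff_subset_Int card_mono add.commute finite_Int inf_le1 le_add_diff_inverse)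
  moreover have "card B = card (B - A) + card (A \<inter> B)"
    using assms(2) by (metis card_Diff_subset_Int card_mono add.commute finite_Int inf_le1
        inf_commute le_add_diff_inverse)
  ultimately show ?thesis by simp
qed

lemma even_card_sym_diff:
  assumes "finite A" "finite B"
  shows "even (card (sym_diff A B)) \<longleftrightarrow> (even (card A) \<longleftrightarrow> even (card B))"
  using card_sym_diff[OF assms] by presburger

lemma pverts_halved_cube [simp]: "A \<in> pverts (halved_cube M) \<longleftrightarrow> A \<subseteq> M \<and> even (card A)"
  by (simp add: halved_cube_def)

lemma parcs_halved_cube:
  "A \<in> pverts (halved_cube M) \<Longrightarrow> B \<in> pverts (halved_cube M) \<Longrightarrow>
    (A, B) \<in> parcs (halved_cube M) \<longleftrightarrow> card (sym_diff A B) = 2"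
  by (simp add: halved_cube_def)

section \<open>The two families of automorphisms: translations and permutations of points\<close>

definition translation :: "'a set \<Rightarrow> 'a set \<Rightarrow> 'a set \<Rightarrow> 'a set" where
  "translation M C = (\<lambda>A \<in> pverts (halved_cube M). sym_diff C A)"

definition image_aut :: "'a set \<Rightarrow> ('a \<Rightarrow> 'a) \<Rightarrow> 'a set \<Rightarrow> 'a set" where
  "image_aut M \<sigma> = (\<lambda>A \<in> pverts (halved_cube M). \<sigma> ` A)"

lemma sym_diff_in_verts:
  assumes "finite M" "A \<in> pverts (halved_cube M)" "B \<in> pverts (halved_cube M)"
  shows "sym_diff A B \<in> pverts (halved_cube M)"
proof -
  have "finite A" "finite B" using assms by (auto intro: finite_subset)
  then show ?thesis using assms by (auto simp: even_card_sym_diff)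
qed

lemma image_in_verts:
  assumes "\<sigma> permutes M" "A \<in> pverts (halved_cube M)"
  shows "\<sigma> ` A \<in> pverts (halved_cube M)"
  using assms by (auto simp: card_image permutes_inj_on permutes_in_image)

text \<open>Symmetric difference is addition over the field with two elements: translating twice by
  \<open>C\<close> is the identity, and \<open>C\<close> cancels in the symmetric difference of two
  translated sets.\<close>

lemma translation_in_graph_aut:
  assumes "finite M" "C \<in> pverts (halved_cube M)"
  shows "translation M C \<in> graph_aut (halved_cube M)"
proof -
  have eq: "sym_diff (sym_diff C A) (sym_diff C B) = sym_diff A B" for A B by blast
  have closed: "sym_diff C A \<in> pverts (halved_cube M)" if "A \<in> pverts (halved_cube M)" for A
    using sym_diff_in_verts[OF assms that] .
  have "sym_diff C (sym_diff C A) = A" for A by blast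
  then have "bij_betw (\<lambda>A. sym_diff C A) (pverts (halved_cube M)) (pverts (halved_cube M))"
    using closed by (intro bij_betw_byWitness[where f' = "\<lambda>A. sym_diff C A"]) blast+
  then have "translation M C \<in> Bij (pverts (halved_cube M))"
    by (simp add: Bij_def translation_def del: pverts_halved_cube)
  then show ?thesis
    using closed
    by (simp add: graph_aut_def translation_def parcs_halved_cube eq del: pverts_halved_cube)
qed

text \<open>Images under an injective map commute with symmetric difference and preserve
  cardinality, and adjacency is defined from these two alone.\<close>

lemma image_aut_in_graph_aut:
  assumes "\<sigma> permutes M"
  shows "image_aut M \<sigma> \<in> graph_aut (halved_cube M)"
proof -
  have inj: "inj \<sigma>" using assms by (rule permutes_inj)
  have eq: "sym_diff (\<sigma> ` A) (\<sigma> ` B) = \<sigma> ` sym_diff A B" for A B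
    using inj by (simp add: image_Un image_set_diff)
  have card: "card (\<sigma> ` A) = card A" for A
    using inj by (simp add: card_image inj_on_def)
  have closed: "\<tau> ` A \<in> pverts (halved_cube M)" if "\<tau> permutes M" "A \<in> pverts (halved_cube M)" for A \<tau>
    using image_in_verts[OF that] .
  have "bij_betw (\<lambda>A. \<sigma> ` A) (pverts (halved_cube M)) (pverts (halved_cube M))"
    using closed[OF assms] closed[OF permutes_inv[OF assms]] permutes_inv_o[OF assms]
    by (intro bij_betw_byWitness[where f' = "\<lambda>A. inv' \<sigma> ` A"])
       (auto simp del: pverts_halved_cube simp: image_comp)
  then have "image_aut M \<sigma> \<in> Bij (pverts (halved_cube M))"
    by (simp add: Bij_def image_aut_def del: pverts_halved_cube)
  then show ?thesis
    using closed[OF assms]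
    by (simp add: graph_aut_def image_aut_def parcs_halved_cube eq card del: pverts_halved_cube)
qed

section \<open>Automorphisms fixing the empty set\<close>

text \<open>Seen as edges of a graph, pairwise meeting pairs form a star or lie in a triangle, and a
  triangle has only three edges.\<close>

lemma pairwise_intersecting_pairs:
  assumes card2: "\<And>A. A \<in> F \<Longrightarrow> card A = 2"
    and meet: "\<And>A B. A \<in> F \<Longrightarrow> B \<in> F \<Longrightarrow> A \<inter> B \<noteq> {}"
    and "card F > 3"
  shows "\<exists>x. \<forall>A \<in> F. x \<in> A"
proof (rule ccontr)
  assume no: "\<nexists>x. \<forall>A \<in> F. x \<in> A"
  obtain A where A: "A \<in> F" using \<open>card F > 3\<close> by fastforce
  then obtain a b where ab: "A = {a, b}" "a \<noteq> b" using card2 card_2_iff by metis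
  obtain B where B: "B \<in> F" "a \<notin> B" using no by blast
  then have "b \<in> B" using meet[OF A] ab by blast
  then obtain c where c: "B = {b, c}" "c \<noteq> b" "c \<noteq> a" using B card2[of B] card_2_iff[of B] by blast
  obtain C where C: "C \<in> F" "b \<notin> C" using no by blast
  \<comment> \<open>\<open>B\<close> avoids \<open>a\<close>, so it contains \<open>b\<close>;
    \<open>C\<close> avoids \<open>b\<close>, so it must be \<open>{a, c}\<close>. A pair meeting
    all three sides of this triangle is itself a side.\<close>
  have "F \<subseteq> {{a, b}, {b, c}, {a, c}}"
  proof
    fix D assume D: "D \<in> F"
    then obtain x y where "D = {x, y}" "x \<noteq> y" using card2 card_2_iff by metis
    moreover have "a \<in> C" "c \<in> C" using C meet[OF A] meet[OF B(1)] ab c by blast+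
    then have "C = {a, c}" using card2[OF C(1)] c card_2_iff[of C] by auto
    ultimately show "D \<in> {{a, b}, {b, c}, {a, c}}"
      using meet[OF D A] meet[OF D B(1)] meet[OF D C(1)] ab c by auto
  qed
  then have "card F \<le> card {{a, b}, {b, c}, {a, c}}" by (intro card_mono) auto
  also have "\<dots> \<le> 3" by (simp add: card_insert_if)
  finally show False using \<open>card F > 3\<close> by simp
qed

text \<open>
  Induction on the size of \<open>A\<close>: if \<open>card A \<ge> 4\<close>, then by injectivity the image of \<open>A\<close> is not
  smaller than \<open>A\<close>, and it is adjacent to every \<open>A - {i, j}\<close>; hence it contains all of these.
\<close>

lemma fixes_pairs_imp_fixes_all:
  assumes M: "finite M" and f: "f \<in> graph_aut (halved_cube M)" and empty: "f {} = {}"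
    and pairs: "\<And>A. A \<subseteq> M \<Longrightarrow> card A = 2 \<Longrightarrow> f A = A"
    and A: "A \<in> pverts (halved_cube M)"
  shows "f A = A"
  using A
proof (induction "card A" arbitrary: A rule: less_induct)
  case less
  have finA: "finite A" using less.prems M by (auto intro: finite_subset)
  consider "card A = 0" | "card A = 2" | "card A \<ge> 4"
    using less.prems by fastforce
  then show ?case
  proof cases
    case 1
    then show ?thesis using finA empty by simp
  next
    case 2
    then show ?thesis using less.prems pairs by simp
  next
    case 3
    have fA: "f A \<in> pverts (halved_cube M)" using f less.prems by (rule graph_aut_in_verts)
    then have finfA: "finite (f A)" using M by (auto intro: finite_subset)
    \<comment> \<open>If the image were smaller, the induction hypothesis would fix
      \<open>f A\<close>, and injectivity would give \<open>f A = A\<close>.\<close>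
    have big: "card A \<le> card (f A)"
    proof (rule ccontr)
      assume small: "\<not> card A \<le> card (f A)"
      then have "f (f A) = f A" using less.hyps fA by simp
      then have "f A = A" using graph_aut_inj[OF f fA less.prems] by simp
      with small show False by simp
    qed
    have sub: "A - {i, j} \<subseteq> f A \<and> card (f A) = card A" if ij: "i \<in> A" "j \<in> A" "i \<noteq> j" for i j
    proof -
      let ?B = "A - {i, j}"
      have cB: "card ?B = card A - 2" using ij finA by (simp add: card_Diff_subset)
      then have B: "?B \<in> pverts (halved_cube M)" using less.prems 3 by auto
      have "f ?B = ?B" using less.hyps[of ?B] B cB 3 by simp
      moreover have "sym_diff A ?B = {i, j}" using ij by blast
      then have "card (sym_diff A ?B) = 2" using ij by simp
      then have "(f A, f ?B) \<in> parcs (halved_cube M)"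
        using B f less.prems by (simp add: graph_aut_arc_iff parcs_halved_cube)
      ultimately have "card (sym_diff (f A) ?B) = 2"
        using B fA by (simp add: parcs_halved_cube)
      then have "2 + 2 * card (f A \<inter> ?B) = card (f A) + card ?B"
        using card_sym_diff[of "f A" ?B] finA finfA by simp
      moreover have "card (f A \<inter> ?B) \<le> card ?B" using finA by (intro card_mono) auto
      \<comment> \<open>The intersection has at most \<open>card A - 2\<close> points, so the
        equation bounds \<open>card (f A)\<close> above by \<open>card A\<close>. With
        \<open>big\<close> both estimates become equalities.\<close>
      ultimately have eq: "card (f A \<inter> ?B) = card ?B" "card (f A) = card A"
        using big cB 3 by linarith+
      then have "f A \<inter> ?B = ?B" using finA by (intro card_subset_eq) auto
      with eq show ?thesis by blast
    qed
    have "x \<in> f A \<and> card (f A) = card A" if x: "x \<in> A" for x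
    proof -
      \<comment> \<open>As \<open>A\<close> has at least four points, some pair in \<open>A\<close>
        avoids \<open>x\<close>; removing that pair leaves a set that contains \<open>x\<close> and
        lies inside \<open>f A\<close>.\<close>
      have "card (A - {x}) \<ge> 2" using 3 x finA by simp
      then obtain T where "T \<subseteq> A - {x}" "card T = 2" by (meson obtain_subset_with_card_n)
      then obtain i j where "i \<in> A" "j \<in> A" "i \<noteq> j" "x \<notin> {i, j}"
        by (auto simp: card_2_iff)
      then show ?thesis using sub[of i j] x by blast
    qed
    moreover have "A \<noteq> {}" using 3 by auto
    ultimately have "A \<subseteq> f A" "card (f A) = card A" by blast+
    then show ?thesis using finfA by (metis card_subset_eq)
  qed
qed

text \<open>
  The pairs containing a point \<open>i\<close> are pairwise adjacent, and since there are at least four of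
  them, their images share a point \<open>\<sigma> i\<close>.
\<close>

lemma graph_aut_fixing_empty:
  assumes M: "finite M" "card M \<ge> 5" and f: "f \<in> graph_aut (halved_cube M)" and empty: "f {} = {}"
  obtains \<sigma> where "\<sigma> permutes M" "f = image_aut M \<sigma>"
proof -
  let ?V = "pverts (halved_cube M)"
  have pair: "{i, j} \<in> ?V" if "i \<in> M" "j \<in> M" "i \<noteq> j" for i j
    using that by simp
  \<comment> \<open>The neighbours of the empty set are exactly the pairs, and \<open>f\<close>
    fixes the empty set.\<close>
  have f_pair: "f {i, j} \<subseteq> M \<and> card (f {i, j}) = 2" if "i \<in> M" "j \<in> M" "i \<noteq> j" for i j
  proof -
    have "({}, {i, j}) \<in> parcs (halved_cube M)"
      using that by (simp add: parcs_halved_cube)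
    then have "({}, f {i, j}) \<in> parcs (halved_cube M)"
      using graph_aut_arc_iff[OF f _ pair[OF that], of "{}"] empty by simp
    then show ?thesis
      using graph_aut_in_verts[OF f pair[OF that]] by (simp add: parcs_halved_cube)
  qed
  have star: "\<exists>x. \<forall>j \<in> M - {i}. x \<in> f {i, j}" if i: "i \<in> M" for i
  proof -
    let ?F = "(\<lambda>j. f {i, j}) ` (M - {i})"
    have "\<exists>x. \<forall>A \<in> ?F. x \<in> A"
    proof (rule pairwise_intersecting_pairs)
      show "card A = 2" if "A \<in> ?F" for A
        using that f_pair i by auto
      show "A \<inter> B \<noteq> {}" if AB: "A \<in> ?F" "B \<in> ?F" for A B
      proof -
        obtain j where j: "j \<in> M" "j \<noteq> i" "A = f {i, j}" using AB(1) by auto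
        obtain k where k: "k \<in> M" "k \<noteq> i" "B = f {i, k}" using AB(2) by auto
        have A: "A \<subseteq> M" "card A = 2" and B: "B \<subseteq> M" "card B = 2"
          using f_pair[of i j] f_pair[of i k] i j k by auto
        show ?thesis
        proof (cases "j = k")
          case True
          then show ?thesis using j k A by auto
        next
          case False
          have "sym_diff {i, j} {i, k} = {j, k}" using j k False by auto
          then have "card (sym_diff {i, j} {i, k}) = 2" using False by simp
          moreover have V: "{i, j} \<in> ?V" "{i, k} \<in> ?V"
            using pair i j k by metis+
          ultimately have "(A, B) \<in> parcs (halved_cube M)"
            unfolding j k graph_aut_arc_iff[OF f V] parcs_halved_cube[OF V] by blast
          then have "card (sym_diff A B) = 2"
            by (simp add: halved_cube_def)
          moreover have "finite A" "finite B" using A B M finite_subset by auto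
          ultimately have "card (A \<inter> B) = 1"
            using card_sym_diff[of A B] A B by simp
          then show ?thesis by auto
        qed
      qed
      \<comment> \<open>The family \<open>?F\<close> is thus as large as \<open>M - {i}\<close>,
        which has at least four elements; this excludes the triangle.\<close>
      have "inj_on (\<lambda>j. f {i, j}) (M - {i})"
      proof (rule inj_onI)
        fix j k assume "j \<in> M - {i}" "k \<in> M - {i}" "f {i, j} = f {i, k}"
        then have "{i, j} = {i, k}"
          using graph_aut_inj[OF f pair[of i j] pair[of i k]] i by auto
        then show "j = k" by (auto simp: doubleton_eq_iff)
      qed
      then show "card ?F > 3"
        using M i by (simp add: card_image)
    qed
    then show ?thesis by blast
  qed
  then obtain s where s: "\<And>i j. i \<in> M \<Longrightarrow> j \<in> M \<Longrightarrow> j \<noteq> i \<Longrightarrow> s i \<in> f {i, j}"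
    by (metis (no_types) Diff_iff singletonD)
  have other: "\<exists>x \<in> M. x \<notin> S" if "finite S" "card S < 5" for S
    using that M by (metis card_mono leD less_le_trans subsetI)
  have s_M: "s i \<in> M" if "i \<in> M" for i
  proof -
    obtain j where "j \<in> M" "j \<noteq> i" using other[of "{i}"] by auto
    then show ?thesis using s[of i j] f_pair[of i j] that by auto
  qed
  \<comment> \<open>If two points had the same image under \<open>s\<close>, there would be disjoint
    pairs \<open>{i, j}\<close> and \<open>{i', k}\<close> whose images are distinct but share a
    point. The images would be adjacent, whereas the disjoint pairs are not.\<close>
  have s_inj: "inj_on s M"
  proof (rule inj_onI, rule ccontr)
    fix i i' assume i: "i \<in> M" "i' \<in> M" "s i = s i'" "i \<noteq> i'"
    obtain j where j: "j \<in> M" "j \<notin> {i, i'}" using other[of "{i, i'}"] i by auto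
    obtain k where k: "k \<in> M" "k \<notin> {i, i', j}" using other[of "{i, i', j}"] i j by auto
    have A: "f {i, j} \<subseteq> M" "card (f {i, j}) = 2" and B: "f {i', k} \<subseteq> M" "card (f {i', k}) = 2"
      using f_pair[of i j] f_pair[of i' k] i j k by auto
    then have fin: "finite (f {i, j})" "finite (f {i', k})" using M finite_subset by auto
    have V: "{i, j} \<in> ?V" "{i', k} \<in> ?V" using pair i j k by auto
    have "s i \<in> f {i, j} \<inter> f {i', k}" using s[of i j] s[of i' k] i j k by auto
    then have "card (f {i, j} \<inter> f {i', k}) \<noteq> 0" using fin by auto
    moreover have "f {i, j} \<noteq> f {i', k}"
      using graph_aut_inj[OF f V] i j k by (auto simp: doubleton_eq_iff)
    then have "card (sym_diff (f {i, j}) (f {i', k})) \<noteq> 0"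
      using fin by auto
    ultimately have "card (sym_diff (f {i, j}) (f {i', k})) = 2"
      using card_sym_diff[OF fin] A(2) B(2) by presburger
    then have "({i, j}, {i', k}) \<in> parcs (halved_cube M)"
      unfolding graph_aut_arc_iff[OF f V, symmetric]
        parcs_halved_cube[OF graph_aut_in_verts[OF f V(1)] graph_aut_in_verts[OF f V(2)]] .
    moreover have "sym_diff {i, j} {i', k} = {i, j, i', k}" using i j k by auto
    ultimately have "card {i, j, i', k} = 2"
      unfolding parcs_halved_cube[OF V] by metis
    then show False using i j k by auto
  qed
  \<comment> \<open>The relation \<open>permutes\<close> demands the identity outside
    \<open>M\<close>, where the choice function \<open>s\<close> is arbitrary.\<close>
  define \<sigma> where "\<sigma> x = (if x \<in> M then s x else x)" for x
  have \<sigma>: "\<sigma> permutes M"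
  proof (rule bij_imp_permutes)
    have "bij_betw s M M"
      using s_inj s_M M by (simp add: bij_betw_def endo_inj_surj image_subsetI)
    then show "bij_betw \<sigma> M M"
      by (simp add: \<sigma>_def cong: bij_betw_cong)
  qed (simp add: \<sigma>_def)
  have f_eq: "f {i, j} = \<sigma> ` {i, j}" if ij: "i \<in> M" "j \<in> M" "i \<noteq> j" for i j
  proof -
    have "s i \<in> f {i, j}" "s j \<in> f {i, j}"
      using s[of i j] s[of j i] ij by (auto simp: insert_commute)
    moreover have "s i \<noteq> s j" using s_inj ij by (auto simp: inj_on_def)
    moreover have "card (f {i, j}) = 2" using f_pair ij by blast
    ultimately have "f {i, j} = {s i, s j}" by (auto simp: card_2_iff)
    then show ?thesis using ij by (simp add: \<sigma>_def)
  qed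
  \<comment> \<open>Undoing \<sigma> after \<open>f\<close> gives an automorphism that fixes the
    empty set and every pair, hence every vertex.\<close>
  define g where "g = compose ?V (image_aut M (inv' \<sigma>)) f"
  have g: "g \<in> graph_aut (halved_cube M)"
    unfolding g_def using image_aut_in_graph_aut[OF permutes_inv[OF \<sigma>]] f by (rule compose_graph_aut)
  have g_eq: "g A = inv' \<sigma> ` f A" if "A \<in> ?V" for A
    using that graph_aut_in_verts[OF f that]
    by (simp add: g_def compose_eq image_aut_def del: pverts_halved_cube)
  have "f A = \<sigma> ` A" if A: "A \<in> ?V" for A
  proof -
    have "g A = A"
    proof (rule fixes_pairs_imp_fixes_all[OF M(1) g _ _ A])
      show "g {} = {}" by (simp add: g_eq empty)
      show "g B = B" if B: "B \<subseteq> M" "card B = 2" for B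
      proof -
        obtain i j where "B = {i, j}" "i \<noteq> j" using B by (auto simp: card_2_iff)
        then show ?thesis
          using B f_eq[of i j] g_eq[of B] permutes_inverses(2)[OF \<sigma>] by simp
      qed
    qed
    then have "\<sigma> ` inv' \<sigma> ` f A = \<sigma> ` A" using g_eq[OF A] by simp
    then show ?thesis by (simp add: image_comp permutes_inv_o[OF \<sigma>])
  qed
  then have "f = image_aut M \<sigma>"
    using graph_aut_extensional[OF f]
    by (intro extensionalityI[of _ ?V]) (simp_all add: image_aut_def del: pverts_halved_cube)
  with \<sigma> show thesis by (rule that)
qed

text \<open>Translation by \<open>f {}\<close> sends \<open>f {}\<close> back to the empty set,
  which reduces the claim to \<open>graph_aut_fixing_empty\<close>. This translation is its own
  inverse, so the same one recovers \<open>f\<close>.\<close>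

lemma graph_aut_halved_cube:
  assumes M: "finite M" "card M \<ge> 5" and f: "f \<in> graph_aut (halved_cube M)"
  obtains C \<sigma> where "C \<in> pverts (halved_cube M)" "\<sigma> permutes M"
    "f = compose (pverts (halved_cube M)) (translation M C) (image_aut M \<sigma>)"
proof -
  let ?V = "pverts (halved_cube M)"
  have C: "f {} \<in> ?V" using f by (rule graph_aut_in_verts) simp
  let ?t = "translation M (f {})"
  have t: "?t \<in> graph_aut (halved_cube M)" using M(1) C by (rule translation_in_graph_aut)
  define g where "g = compose ?V ?t f"
  have g: "g \<in> graph_aut (halved_cube M)" unfolding g_def using t f by (rule compose_graph_aut)
  have g_eq: "g A = sym_diff (f {}) (f A)" if "A \<in> ?V" for A
    using that graph_aut_in_verts[OF f that]
    by (simp add: g_def compose_eq translation_def del: pverts_halved_cube)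
  then have "g {} = {}" by simp
  then obtain \<sigma> where \<sigma>: "\<sigma> permutes M" "g = image_aut M \<sigma>"
    using graph_aut_fixing_empty[OF M g] by blast
  have "f = compose ?V ?t (image_aut M \<sigma>)"
  proof (rule extensionalityI[of _ ?V])
    fix A assume A: "A \<in> ?V"
    have "compose ?V ?t g A = sym_diff (f {}) (g A)"
      using A graph_aut_in_verts[OF g A]
      by (simp add: compose_eq translation_def del: pverts_halved_cube)
    also have "\<dots> = f A" unfolding g_eq[OF A] by blast
    finally show "f A = compose ?V ?t (image_aut M \<sigma>) A" by (simp add: \<sigma>)
  qed (use f in \<open>auto simp: compose_def graph_aut_extensional\<close>)
  with C \<sigma> show thesis by (blast intro: that)
qed

section \<open>The automorphism group of the halved cube\<close>

text \<open>The point \<open>Suc n\<close> serves as a parity bit. On subsets of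
  \<open>{1..n}\<close> this inverts the map from even sets to their trace on
  \<open>{1..n}\<close>.\<close>

definition even_completion :: "nat \<Rightarrow> nat set \<Rightarrow> nat set" where
  "even_completion n S = (if even (card S) then S else insert (Suc n) S)"

lemma even_completion_in_verts:
  assumes "S \<subseteq> {1..n}"
  shows "even_completion n S \<in> pverts (halved_cube {1..Suc n})"
proof -
  have "finite S" "Suc n \<notin> S" using assms by (auto intro: finite_subset)
  then show ?thesis using assms by (auto simp: even_completion_def)
qed

lemma even_completion_Int: "S \<subseteq> {1..n} \<Longrightarrow> even_completion n S \<inter> {1..n} = S"
  by (auto simp: even_completion_def)

lemma interval_Suc: "{1..Suc n} = insert (Suc n) {1..n}"
  by auto

text \<open>The symmetric difference is contained in \<open>{Suc n}\<close> and has even size, so it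
  is empty. Identities between even sets can therefore be checked on \<open>{1..n}\<close>.\<close>

lemma even_subset_eqI:
  assumes "A \<in> pverts (halved_cube {1..Suc n})" "B \<in> pverts (halved_cube {1..Suc n})"
    and "A \<inter> {1..n} = B \<inter> {1..n}"
  shows "A = B"
proof -
  let ?S = "sym_diff A B"
  have "?S \<subseteq> {1..Suc n}" "?S \<inter> {1..n} = {}"
    using assms by (auto simp only: pverts_halved_cube)
  then have "?S \<subseteq> {Suc n}" unfolding interval_Suc by blast
  then have "?S = {} \<or> ?S = {Suc n}" by (rule subset_singletonD)
  moreover have "even (card ?S)"
    using sym_diff_in_verts[OF _ assms(1,2)] by simp
  then have "?S \<noteq> {Suc n}" by (metis card_1_singleton_iff odd_one One_nat_def)
  ultimately have "?S = {}" by argo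
  then show ?thesis by blast
qed

lemma even_completion_Int_eq:
  assumes "A \<in> pverts (halved_cube {1..Suc n})"
  shows "even_completion n (A \<inter> {1..n}) = A"
proof (rule even_subset_eqI)
  show "even_completion n (A \<inter> {1..n}) \<in> pverts (halved_cube {1..Suc n})"
    by (rule even_completion_in_verts) (rule Int_lower2)
  show "even_completion n (A \<inter> {1..n}) \<inter> {1..n} = A \<inter> {1..n}"
    by (rule even_completion_Int) (rule Int_lower2)
qed (fact assms)

lemma even_completion_sym_diff:
  assumes "S \<subseteq> {1..n}" "T \<subseteq> {1..n}"
  shows "even_completion n (sym_diff S T) = sym_diff (even_completion n S) (even_completion n T)"
proof (rule even_subset_eqI)
  show "even_completion n (sym_diff S T) \<in> pverts (halved_cube {1..Suc n})"
    using assms by (intro even_completion_in_verts) blast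
  show "sym_diff (even_completion n S) (even_completion n T) \<in> pverts (halved_cube {1..Suc n})"
    using assms by (intro sym_diff_in_verts even_completion_in_verts) auto
  have "sym_diff S T \<subseteq> {1..n}" using assms by blast
  then have "even_completion n (sym_diff S T) \<inter> {1..n} = sym_diff S T"
    by (rule even_completion_Int)
  also have "\<dots> = sym_diff (even_completion n S) (even_completion n T) \<inter> {1..n}"
    using even_completion_Int[OF assms(1)] even_completion_Int[OF assms(2)] by blast
  finally show "even_completion n (sym_diff S T) \<inter> {1..n} =
      sym_diff (even_completion n S) (even_completion n T) \<inter> {1..n}" .
qed

section \<open>Composition rules for translations and permutations\<close>

lemma translation_sym_diff:
  assumes "finite M" "C \<in> pverts (halved_cube M)" "D \<in> pverts (halved_cube M)"
  shows "translation M (sym_diff C D) =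
    translation M C \<otimes>\<^bsub>graph_aut_group (halved_cube M)\<^esub> translation M D"
proof -
  have eq: "sym_diff (sym_diff C D) A = sym_diff C (sym_diff D A)" for A by blast
  have "translation M (sym_diff C D) A =
      compose (pverts (halved_cube M)) (translation M C) (translation M D) A" for A
  proof (cases "A \<in> pverts (halved_cube M)")
    case True
    show ?thesis
      using True sym_diff_in_verts[OF assms(1,3) True]
      by (simp only: translation_def compose_def restrict_apply eq if_True)
  next
    case False
    then show ?thesis by (simp only: translation_def compose_def restrict_apply if_False)
  qed
  then show ?thesis
    using assms by (simp only: mult_graph_aut_group translation_in_graph_aut) blast
qed

lemma image_aut_comp:
  assumes "\<sigma> permutes M" "\<tau> permutes M"
  shows "image_aut M (\<sigma> \<circ> \<tau>) =
    image_aut M \<sigma> \<otimes>\<^bsub>graph_aut_group (halved_cube M)\<^esub> image_aut M \<tau>"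
proof -
  have "image_aut M (\<sigma> \<circ> \<tau>) A =
      compose (pverts (halved_cube M)) (image_aut M \<sigma>) (image_aut M \<tau>) A" for A
  proof (cases "A \<in> pverts (halved_cube M)")
    case True
    then show ?thesis
      using image_in_verts[OF assms(2) True]
      by (simp only: image_aut_def compose_def restrict_apply image_comp if_True)
  next
    case False
    then show ?thesis by (simp only: image_aut_def compose_def restrict_apply if_False)
  qed
  then show ?thesis
    using assms by (simp only: mult_graph_aut_group image_aut_in_graph_aut) blast
qed

text \<open>Single points are not vertices, so \<sigma> is read off from pairs: the images of
  \<open>{i, j}\<close> and \<open>{i, k}\<close> have only the image of \<open>i\<close> in common.
  Hence the need for three points.\<close>

lemma image_aut_inj:
  assumes M: "finite M" "card M \<ge> 3" and perm: "\<sigma> permutes M" "\<tau> permutes M"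
    and eq: "image_aut M \<sigma> = image_aut M \<tau>"
  shows "\<sigma> = \<tau>"
proof
  fix i
  show "\<sigma> i = \<tau> i"
  proof (cases "i \<in> M")
    case True
    have "card (M - {i}) \<ge> 2" using M True by simp
    then obtain T where T: "T \<subseteq> M - {i}" "card T = 2" by (meson obtain_subset_with_card_n)
    then obtain j k where jk: "j \<in> M" "k \<in> M" "j \<noteq> i" "k \<noteq> i" "j \<noteq> k" by (auto simp: card_2_iff)
    have "\<sigma> ` {i, l} = \<tau> ` {i, l}" if "l \<in> M" "l \<noteq> i" for l
      using fun_cong[OF eq, of "{i, l}"] True that by (simp add: image_aut_def)
    then have "\<sigma> i \<in> {\<tau> i, \<tau> j}" "\<sigma> i \<in> {\<tau> i, \<tau> k}" using jk by blast+
    moreover have "\<tau> j \<noteq> \<tau> k" using jk perm(2) by (simp add: permutes_inj inj_eq)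
    ultimately show ?thesis by auto
  next
    case False
    then show ?thesis using perm by (simp add: permutes_not_in)
  qed
qed

text \<open>An injective image distributes over symmetric difference. This commutation rule is the
  source of normality.\<close>

lemma image_aut_translation:
  assumes M: "finite M" and \<sigma>: "\<sigma> permutes M" and C: "C \<in> pverts (halved_cube M)"
  shows "image_aut M \<sigma> \<otimes>\<^bsub>graph_aut_group (halved_cube M)\<^esub> translation M C =
    translation M (\<sigma> ` C) \<otimes>\<^bsub>graph_aut_group (halved_cube M)\<^esub> image_aut M \<sigma>"
proof -
  let ?V = "pverts (halved_cube M)"
  have inj: "inj \<sigma>" using \<sigma> by (rule permutes_inj)
  have eq: "\<sigma> ` sym_diff C A = sym_diff (\<sigma> ` C) (\<sigma> ` A)" for A
    using inj by (simp add: image_Un image_set_diff)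
  have "compose ?V (image_aut M \<sigma>) (translation M C) A =
      compose ?V (translation M (\<sigma> ` C)) (image_aut M \<sigma>) A" for A
  proof (cases "A \<in> ?V")
    case True
    then show ?thesis
      using image_in_verts[OF \<sigma> True] sym_diff_in_verts[OF M C True]
      by (simp only: translation_def image_aut_def compose_def restrict_apply eq if_True)
  next
    case False
    then show ?thesis by (simp only: compose_def restrict_apply if_False)
  qed
  then show ?thesis
    using image_in_verts[OF \<sigma> C] assms
    by (simp only: mult_graph_aut_group translation_in_graph_aut image_aut_in_graph_aut) blast
qed

text \<open>A 0-1 vector acts as the translation by its support completed to an even set; this set
  is \<open>E p\<close>. The map \<open>E\<close> matches the vectors bijectively with the vertices
  and turns addition into symmetric difference.\<close>

lemma iso_semidirect_product_halved_cube:
  assumes n: "n \<ge> 4"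
  shows "iso_semidirect_product (graph_aut_group (halved_cube {1..Suc n}))
    (product_group {1..n} (\<lambda>_. integer_mod_group 2)) (sym_group (Suc n))"
proof -
  let ?M = "{1..Suc n}"
  let ?V = "pverts (halved_cube ?M)"
  let ?G = "graph_aut_group (halved_cube ?M)"
  let ?A = "product_group {1..n} (\<lambda>_. integer_mod_group 2)"
  define supp :: "(nat \<Rightarrow> int) \<Rightarrow> nat set" where "supp p = {i \<in> {1..n}. p i = 1}" for p
  define E where "E p = even_completion n (supp p)" for p
  have supp: "supp p \<subseteq> {1..n}" for p by (auto simp: supp_def)
  have E: "E p \<in> ?V" for p
    unfolding E_def using supp by (rule even_completion_in_verts)
  have carrier: "p \<in> carrier ?A \<longleftrightarrow> p \<in> extensional {1..n} \<and> (\<forall>i \<in> {1..n}. p i = 0 \<or> p i = 1)" for p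
    by (auto simp: PiE_iff carrier_integer_mod_group)
  have E_surj: "\<exists>p \<in> carrier ?A. E p = C" if C: "C \<in> ?V" for C
  proof
    let ?p = "\<lambda>i \<in> {1..n}. of_bool (i \<in> C) :: int"
    show "?p \<in> carrier ?A" unfolding carrier by auto
    have "supp ?p = C \<inter> {1..n}" by (auto simp: supp_def)
    then show "E ?p = C" unfolding E_def using even_completion_Int_eq[OF C] by simp
  qed
  have E_mult: "E (p \<otimes>\<^bsub>?A\<^esub> q) = sym_diff (E p) (E q)" if "p \<in> carrier ?A" "q \<in> carrier ?A" for p q
  proof -
    \<comment> \<open>On 0 and 1, addition modulo 2 is exclusive or, so supports combine by
      symmetric difference.\<close>
    have "(p i + q i) mod 2 = 1 \<longleftrightarrow> (p i = 1) \<noteq> (q i = 1)" if "i \<in> {1..n}" for i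
    proof -
      have "p i = 0 \<or> p i = 1" "q i = 0 \<or> q i = 1"
        using \<open>p \<in> carrier ?A\<close> \<open>q \<in> carrier ?A\<close> that unfolding carrier by blast+
      then show ?thesis by auto
    qed
    then have "supp (p \<otimes>\<^bsub>?A\<^esub> q) = sym_diff (supp p) (supp q)" by (auto simp: supp_def)
    then show ?thesis unfolding E_def using even_completion_sym_diff[OF supp supp] by simp
  qed
  have E_inj: "p = q" if "p \<in> carrier ?A" "q \<in> carrier ?A" "E p = E q" for p q
  proof (rule extensionalityI[of _ "{1..n}"])
    have "supp p = supp q"
      using that(3) even_completion_Int[OF supp[of p]] even_completion_Int[OF supp[of q]]
      by (simp add: E_def)
    then have "p i = 1 \<longleftrightarrow> q i = 1" if "i \<in> {1..n}" for i
      using that unfolding supp_def by blast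
    then show "p i = q i" if "i \<in> {1..n}" for i
      using that \<open>p \<in> carrier ?A\<close> \<open>q \<in> carrier ?A\<close> unfolding carrier by metis
  qed (use that carrier in auto)
  \<comment> \<open>A translation is determined by its value at the empty set; this yields
    injectivity here and the trivial intersection below.\<close>
  have translation_empty: "translation ?M C {} = C" for C :: "nat set"
    by (simp add: translation_def)
  have auts: "translation ?M (E p) \<in> carrier ?G" for p
    unfolding carrier_graph_aut_group using E by (intro translation_in_graph_aut finite_atLeastAtMost)
  interpret G: group ?G by (rule group_graph_aut_group)
  show ?thesis
  proof (rule iso_semidirect_productI[where \<alpha> = "\<lambda>p. translation ?M (E p)" and \<beta> = "image_aut ?M"])
    show "group ?G" "group ?A" "group (sym_group (Suc n))"
      by (simp_all add: group_graph_aut_group sym_group_is_group)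
    show "(\<lambda>p. translation ?M (E p)) \<in> hom ?A ?G"
    proof (rule homI)
      fix p q assume pq: "p \<in> carrier ?A" "q \<in> carrier ?A"
      show "translation ?M (E (p \<otimes>\<^bsub>?A\<^esub> q)) =
          translation ?M (E p) \<otimes>\<^bsub>?G\<^esub> translation ?M (E q)"
        unfolding E_mult[OF pq] by (rule translation_sym_diff[OF finite_atLeastAtMost E E])
    qed (rule auts)
    show "inj_on (\<lambda>p. translation ?M (E p)) (carrier ?A)"
      by (rule inj_onI) (metis E_inj translation_empty)
    show "image_aut ?M \<in> hom (sym_group (Suc n)) ?G"
      by (auto simp: hom_def sym_group_carrier sym_group_mult image_aut_in_graph_aut image_aut_comp)
    show "inj_on (image_aut ?M) (carrier (sym_group (Suc n)))"
      using n by (intro inj_onI image_aut_inj[of ?M]) (auto simp: sym_group_carrier)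
    have decompose: "\<exists>p \<in> carrier ?A. \<exists>\<sigma> \<in> carrier (sym_group (Suc n)).
        g = translation ?M (E p) \<otimes>\<^bsub>?G\<^esub> image_aut ?M \<sigma>" if "g \<in> carrier ?G" for g
    proof -
      have M: "finite ?M" "card ?M \<ge> 5" "g \<in> graph_aut (halved_cube ?M)"
        using that n by simp_all
      obtain C \<sigma> where C: "C \<in> ?V" and \<sigma>: "\<sigma> permutes ?M"
        and g: "g = compose ?V (translation ?M C) (image_aut ?M \<sigma>)"
        by (rule graph_aut_halved_cube[OF M])
      then have "g = translation ?M C \<otimes>\<^bsub>?G\<^esub> image_aut ?M \<sigma>"
        using C \<sigma> by (simp only: mult_graph_aut_group translation_in_graph_aut image_aut_in_graph_aut
            finite_atLeastAtMost)
      then show ?thesis using E_surj[OF C] \<sigma> sym_group_carrier by metis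
    qed
    show "\<exists>p \<in> carrier ?A. \<exists>\<sigma> \<in> carrier (sym_group (Suc n)).
        g = translation ?M (E p) \<otimes>\<^bsub>?G\<^esub> image_aut ?M \<sigma>" if "g \<in> carrier ?G" for g
      using decompose[OF that] .
    show "\<exists>q \<in> carrier ?A. g \<otimes>\<^bsub>?G\<^esub> translation ?M (E p) = translation ?M (E q) \<otimes>\<^bsub>?G\<^esub> g"
      if g: "g \<in> carrier ?G" and p: "p \<in> carrier ?A" for g p
    proof -
      obtain r \<sigma> where \<sigma>: "\<sigma> permutes ?M"
        and g_eq: "g = translation ?M (E r) \<otimes>\<^bsub>?G\<^esub> image_aut ?M \<sigma>"
        using decompose[OF g] sym_group_carrier by metis
      have i: "image_aut ?M \<sigma> \<in> carrier ?G"
        using image_aut_in_graph_aut[OF \<sigma>] by simp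
      have \<sigma>E: "\<sigma> ` E p \<in> ?V" using image_in_verts[OF \<sigma> E] .
      then obtain q where q: "q \<in> carrier ?A" "E q = \<sigma> ` E p" using E_surj by blast
      \<comment> \<open>Moving a translation past the permutation part of \<open>g\<close> replaces
        \<open>E p\<close> by its image \<open>E q\<close>; moving it past the translation part
        changes nothing, since translations commute.\<close>
      have comm: "translation ?M (E r) \<otimes>\<^bsub>?G\<^esub> translation ?M (E q) =
          translation ?M (E q) \<otimes>\<^bsub>?G\<^esub> translation ?M (E r)"
        using translation_sym_diff[of ?M "E r" "E q"] translation_sym_diff[of ?M "E q" "E r"] E
        by (metis Un_commute finite_atLeastAtMost)
      have "g \<otimes>\<^bsub>?G\<^esub> translation ?M (E p) =
          translation ?M (E r) \<otimes>\<^bsub>?G\<^esub> (image_aut ?M \<sigma> \<otimes>\<^bsub>?G\<^esub> translation ?M (E p))"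
        unfolding g_eq using auts i by (intro G.m_assoc)
      also have "\<dots> = translation ?M (E r) \<otimes>\<^bsub>?G\<^esub> (translation ?M (E q) \<otimes>\<^bsub>?G\<^esub> image_aut ?M \<sigma>)"
        using image_aut_translation[OF _ \<sigma> E] q by simp
      also have "\<dots> = translation ?M (E r) \<otimes>\<^bsub>?G\<^esub> translation ?M (E q) \<otimes>\<^bsub>?G\<^esub> image_aut ?M \<sigma>"
        using auts i by (intro G.m_assoc[symmetric])
      also have "\<dots> = translation ?M (E q) \<otimes>\<^bsub>?G\<^esub> g"
        unfolding comm g_eq using auts i by (intro G.m_assoc)
      finally show ?thesis using q(1) by blast
    qed
    show "translation ?M (E p) = \<one>\<^bsub>?G\<^esub>"
      if "translation ?M (E p) = image_aut ?M \<sigma>" for p \<sigma>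
    proof -
      \<comment> \<open>Every \<open>image_aut\<close> fixes the empty set, whereas the translation
        sends it to \<open>E p\<close>.\<close>
      have "E p = {}"
        using fun_cong[OF that, of "{}"] unfolding translation_empty by (simp add: image_aut_def)
      then show ?thesis
        by (simp add: translation_def one_graph_aut_group)
    qed
  qed
qed

section \<open>The square of the hypercube\<close>

lemma pverts_hypercube: "pverts (hypercube n) = {1..n} \<rightarrow>\<^sub>E {0, 1}"
  by (simp add: hypercube_def)

text \<open>An arc changes one coordinate, so a walk needs at least one arc for each coordinate in
  which its ends differ. Correcting these coordinates one at a time attains the bound.\<close>

lemma graph_dist_hypercube:
  assumes uv: "u \<in> pverts (hypercube n)" "v \<in> pverts (hypercube n)"
  shows "graph_dist (hypercube n) u v = card {i \<in> {1..n}. u i \<noteq> v i}"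
proof -
  interpret pair_graph "hypercube n" by (rule pair_graph_hypercube)
  have cost: "awalk_cost (\<lambda>_. 1) p = real (length p)" for p :: "((nat \<Rightarrow> nat) \<times> (nat \<Rightarrow> nat)) list"
    by (induction p) auto
  have lower: "card {i \<in> {1..n}. u i \<noteq> v i} \<le> length p" if "awalk u p v" for u p
    using that
  proof (induction p arbitrary: u)
    case Nil
    then show ?case by (simp add: awalk_Nil_iff)
  next
    case (Cons e p)
    let ?w = "snd e"
    have e: "(u, ?w) \<in> parcs (hypercube n)" and p: "awalk ?w p v"
      using Cons.prems by (auto simp: awalk_Cons_iff)
    have "card {i \<in> {1..n}. u i \<noteq> v i} \<le>
        card ({i \<in> {1..n}. u i \<noteq> ?w i} \<union> {i \<in> {1..n}. ?w i \<noteq> v i})"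
      by (intro card_mono) auto
    also have "\<dots> \<le> card {i \<in> {1..n}. u i \<noteq> ?w i} + card {i \<in> {1..n}. ?w i \<noteq> v i}"
      by (rule card_Un_le)
    also have "\<dots> \<le> 1 + length p"
      using e Cons.IH[OF p] by (simp add: hypercube_def)
    finally show ?case by simp
  qed
  have upper: "\<exists>p. awalk u p v \<and> length p = card {i \<in> {1..n}. u i \<noteq> v i}"
    using uv(1)
  proof (induction "card {i \<in> {1..n}. u i \<noteq> v i}" arbitrary: u)
    case 0
    then have "u = v"
      using uv(2) by (intro extensionalityI[of u "{1..n}"]) (auto simp: pverts_hypercube PiE_iff)
    then show ?case using uv(2) by (auto simp: awalk_Nil_iff)
  next
    case (Suc k)
    then obtain i where i: "i \<in> {1..n}" "u i \<noteq> v i"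
      by (metis (mono_tags, lifting) card.empty empty_Collect_eq nat.distinct(1))
    let ?w = "u(i := v i)"
    have w: "?w \<in> pverts (hypercube n)"
      using Suc.prems uv(2) i by (auto simp: pverts_hypercube PiE_iff extensional_def)
    have "{j \<in> {1..n}. ?w j \<noteq> v j} = {j \<in> {1..n}. u j \<noteq> v j} - {i}" by auto
    then have k: "k = card {j \<in> {1..n}. ?w j \<noteq> v j}"
      using Suc.hyps(2) i by (simp add: card_Diff_singleton)
    then obtain p where p: "awalk ?w p v" "length p = k"
      using Suc.hyps(1)[OF k w] by auto
    have "{j \<in> {1..n}. u j \<noteq> ?w j} = {i}" using i by auto
    then have "(u, ?w) \<in> parcs (hypercube n)"
      using Suc.prems w by (simp add: hypercube_def)
    then have "awalk u ((u, ?w) # p) v"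
      using p by (simp add: awalk_Cons_iff)
    then show ?case using p Suc.hyps(2) by (metis length_Cons)
  qed
  show ?thesis
  proof (rule antisym)
    show "graph_dist (hypercube n) u v \<le> card {i \<in> {1..n}. u i \<noteq> v i}"
      using upper min_cost_le_walk_cost[of u _ v "\<lambda>_. 1"] unfolding graph_dist_def cost by metis
    show "card {i \<in> {1..n}. u i \<noteq> v i} \<le> graph_dist (hypercube n) u v"
      unfolding graph_dist_def \<mu>_def cost using lower by (intro INF_greatest) simp
  qed
qed

text \<open>The graph isomorphism restricts the characteristic function of an even set to
  \<open>{1..n}\<close>; the forgotten coordinate is recovered from parity.\<close>

lemma graph_aut_group_square_hypercube:
  "graph_aut_group (halved_cube {1..Suc n}) \<cong> graph_aut_group (graph_square (hypercube n))"
proof (rule graph_aut_group_cong)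
  let ?M = "{1..Suc n}"
  let ?V = "pverts (halved_cube ?M)"
  let ?h = "\<lambda>A. \<lambda>i \<in> {1..n}. of_bool (i \<in> A) :: nat"
  have verts: "pverts (graph_square (hypercube n)) = {1..n} \<rightarrow>\<^sub>E {0, 1}"
    by (simp add: graph_square_def pverts_hypercube)
  have h: "?h A \<in> {1..n} \<rightarrow>\<^sub>E {0, 1}" for A by auto
  have diff: "{i \<in> {1..n}. ?h A i \<noteq> ?h B i} = sym_diff A B \<inter> {1..n}" for A B
    by auto
  show "bij_betw ?h ?V (pverts (graph_square (hypercube n)))"
    unfolding bij_betw_def verts
  proof
    show "inj_on ?h ?V"
    proof (rule inj_onI)
      fix A B assume "A \<in> ?V" "B \<in> ?V" "?h A = ?h B"
      then show "A = B" using diff[of A B] by (intro even_subset_eqI[of A n B]) auto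
    qed
    show "?h ` ?V = {1..n} \<rightarrow>\<^sub>E {0, 1}"
    proof
      show "?h ` ?V \<subseteq> {1..n} \<rightarrow>\<^sub>E {0, 1}"
        by (rule image_subsetI) (rule h)
      show "{1..n} \<rightarrow>\<^sub>E {0, 1} \<subseteq> ?h ` ?V"
      proof
        fix x :: "nat \<Rightarrow> nat" assume x: "x \<in> {1..n} \<rightarrow>\<^sub>E {0, 1}"
        let ?S = "{i \<in> {1..n}. x i = 1}"
        let ?A = "even_completion n ?S"
        have "i \<in> ?A \<longleftrightarrow> x i = 1" if "i \<in> {1..n}" for i
          using even_completion_Int[of ?S n] that by blast
        then have "x = ?h ?A"
          using x by (intro extensionalityI[of x "{1..n}"]) (auto simp: PiE_iff)
        moreover have "?A \<in> ?V" by (rule even_completion_in_verts) auto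
        ultimately show "x \<in> ?h ` ?V" by blast
      qed
    qed
  qed
  fix A B assume A: "A \<in> ?V" and B: "B \<in> ?V"
  let ?S = "sym_diff A B"
  have S: "?S \<subseteq> ?M" "even (card ?S)"
    using sym_diff_in_verts[OF _ A B] by simp_all
  then have fin: "finite ?S" by (auto intro: finite_subset)
  have "?S \<inter> {1..n} = ?S - {Suc n}"
    using S(1) by (fastforce simp: interval_Suc)
  then have card: "card (?S \<inter> {1..n}) = (if Suc n \<in> ?S then card ?S - 1 else card ?S)"
    using fin by (simp add: card_Diff_singleton_if)
  have "?h A = ?h B \<longleftrightarrow> {i \<in> {1..n}. ?h A i \<noteq> ?h B i} = {}"
    by (auto simp: fun_eq_iff)
  then have "?h A \<noteq> ?h B \<longleftrightarrow> card (?S \<inter> {1..n}) \<noteq> 0"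
    unfolding diff using fin by simp
  moreover have "graph_dist (hypercube n) (?h A) (?h B) = card (?S \<inter> {1..n})"
    unfolding diff[symmetric] using h by (intro graph_dist_hypercube) (simp_all only: pverts_hypercube)
  ultimately have "(?h A, ?h B) \<in> parcs (graph_square (hypercube n)) \<longleftrightarrow>
      card (?S \<inter> {1..n}) \<noteq> 0 \<and> card (?S \<inter> {1..n}) \<le> 2"
    using h by (simp add: graph_square_def pverts_hypercube del: restrict_PiE_iff)
  \<comment> \<open>\<open>card ?S\<close> is even and loses at most one when \<open>Suc n\<close>
    is removed. Size 0 stays 0, size 2 gives 1 or 2, and size at least 4 leaves at least 3.\<close>
  also have "\<dots> \<longleftrightarrow> card ?S = 2"
    unfolding card using S(2) fin by (auto elim!: evenE)
  finally show "(?h A, ?h B) \<in> parcs (graph_square (hypercube n)) \<longleftrightarrow> (A, B) \<in> parcs (halved_cube ?M)"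
    unfolding parcs_halved_cube[OF A B] .
qed

theorem theorem3p2:
  fixes n :: nat
  assumes "n > 4"
  shows "iso_semidirect_product
           (graph_aut_group (graph_square (hypercube n)))
           (product_group {1..n} (\<lambda>_. integer_mod_group 2))
           (sym_group (n + 1))"
  using iso_semidirect_product_cong[OF group_graph_aut_group group_graph_aut_group
      graph_aut_group_square_hypercube iso_semidirect_product_halved_cube, of n] assms
  by simp

end
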